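(* Let $A$ be a skew brace. Then $A$ is semiprime if and only if its Baer radical is zero, i.e. $B(A)=0$.
   Context: A skew brace is a triple $(A,+,\circ)$ where $(A,+)$ and $(A,\circ)$ are (not necessarily abelian) groups with $a\circ(b+c)=a\circ b-a+a\circ c$ for all $a,b,c\in A$ (the two groups share the identity element $0$). For $a,b\in A$ put $\lambda_a(b)=-a+a\circ b$ and $a*b=\lambda_a(b)-b$. For subsets $X,Y\subseteq A$, $X*Y$ denotes the subgroup of $(A,+)$ generated by $\{x*y:x\in X,\ y\in Y\}$. An ideal of $A$ is a normal subgroup $I$ of $(A,\circ)$ such that $\lambda_a(I)\subseteq I$ and $a+I=I+a$ for all $a\in A$. For $a\in A$, $\langle a\rangle$ denotes the smallest ideal of $A$ containing $a$. $A$ is semiprime if $I*I\neq 0$ for every non-zero ideal $I$ of $A$. An $n$-sequence in $A$ is a sequence $a_1,a_2,a_3,\ldots$ of elements of $A$ with $a_{i+1}\in\langle a_i\rangle*\langle a_i\rangle$ for all $i\ge 1$. An ideal $I$ of $A$ is Baer radical if every $n$-sequence in $A$ starting with an element of $I$ reaches zero at some point. The Baer radical $B(A)$ is the largest Baer radical ideal of $A$ (it exists: it is the sum of all Baer radical ideals). *)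

theory Defs
  imports "HOL-Algebra.Algebra"
begin

text \<open>
  A skew brace is carried by a HOL-Algebra ring record: \<open>\<oplus>\<close>, \<open>\<zero>\<close> is the (not necessarily
  abelian) additive group, and \<open>\<otimes>\<close>, \<open>\<one>\<close> is the circle group. That \<open>\<one> = \<zero>\<close> is a consequence of the
  axioms. Since \<open>\<oplus>\<close> need not commute, the order of summands matters throughout;
  \<open>x \<ominus> y\<close> is \<open>x \<oplus> (\<ominus> y)\<close>.
\<close>

locale skew_brace =
  fixes A :: "('a, 'b) ring_scheme" (structure)
  assumes add_group: "group (add_monoid A)"
    and circ_group: "group A"
    and skew_distrib: "\<lbrakk>a \<in> carrier A; b \<in> carrier A; c \<in> carrier A\<rbrakk>
      \<Longrightarrow> a \<otimes> (b \<oplus> c) = ((a \<otimes> b) \<ominus> a) \<oplus> (a \<otimes> c)"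

definition sb_lambda :: "('a, 'b) ring_scheme \<Rightarrow> 'a \<Rightarrow> 'a \<Rightarrow> 'a" where
  "sb_lambda A a b = (\<ominus>\<^bsub>A\<^esub> a) \<oplus>\<^bsub>A\<^esub> (a \<otimes>\<^bsub>A\<^esub> b)"

definition sb_star :: "('a, 'b) ring_scheme \<Rightarrow> 'a \<Rightarrow> 'a \<Rightarrow> 'a" where
  "sb_star A a b = sb_lambda A a b \<ominus>\<^bsub>A\<^esub> b"

definition sb_star_set :: "('a, 'b) ring_scheme \<Rightarrow> 'a set \<Rightarrow> 'a set \<Rightarrow> 'a set" where
  "sb_star_set A S T = generate (add_monoid A) {sb_star A x y | x y. x \<in> S \<and> y \<in> T}"

definition sb_ideal :: "('a, 'b) ring_scheme \<Rightarrow> 'a set \<Rightarrow> bool" where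
  "sb_ideal A I \<longleftrightarrow> I \<lhd> A \<and>
     (\<forall>a\<in>carrier A. sb_lambda A a ` I \<subseteq> I \<and> a <+\<^bsub>A\<^esub> I = I +>\<^bsub>A\<^esub> a)"

definition sb_genideal :: "('a, 'b) ring_scheme \<Rightarrow> 'a \<Rightarrow> 'a set" where
  "sb_genideal A a = \<Inter>{I. sb_ideal A I \<and> a \<in> I}"

definition sb_semiprime :: "('a, 'b) ring_scheme \<Rightarrow> bool" where
  "sb_semiprime A \<longleftrightarrow>
     (\<forall>I. sb_ideal A I \<and> I \<noteq> {\<zero>\<^bsub>A\<^esub>} \<longrightarrow> sb_star_set A I I \<noteq> {\<zero>\<^bsub>A\<^esub>})"

text \<open>Sequences are indexed from 0, so \<open>s 0\<close> is the first term.\<close>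

definition n_sequence :: "('a, 'b) ring_scheme \<Rightarrow> (nat \<Rightarrow> 'a) \<Rightarrow> bool" where
  "n_sequence A s \<longleftrightarrow> (\<forall>i. s i \<in> carrier A) \<and>
     (\<forall>i. s (Suc i) \<in> sb_star_set A (sb_genideal A (s i)) (sb_genideal A (s i)))"

definition baer_radical_ideal :: "('a, 'b) ring_scheme \<Rightarrow> 'a set \<Rightarrow> bool" where
  "baer_radical_ideal A I \<longleftrightarrow> sb_ideal A I \<and>
     (\<forall>s. n_sequence A s \<and> s 0 \<in> I \<longrightarrow> (\<exists>i. s i = \<zero>\<^bsub>A\<^esub>))"

text \<open>\<open>GREATEST\<close> is with respect to inclusion of sets.\<close>

definition baer_radical :: "('a, 'b) ring_scheme \<Rightarrow> 'a set" where
  "baer_radical A = (GREATEST I. baer_radical_ideal A I)"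

end

theory Submission
  imports Defs
begin

text \<open>
  Call an ideal \<open>P\<close> semiprime if \<open>J * J \<subseteq> P\<close> implies \<open>J \<subseteq> P\<close> for every ideal \<open>J\<close>. The Baer radical
  is the intersection \<open>Q\<close> of all semiprime ideals, which is itself semiprime; hence it is zero iff
  \<open>0\<close> is semiprime. On the one hand, an element outside a semiprime ideal \<open>P\<close> starts an n-sequence
  that stays outside \<open>P\<close>. On the other hand, if an n-sequence never vanishes, then an ideal \<open>P\<close>
  maximal among those avoiding it is semiprime: if \<open>J * J \<subseteq> P\<close> and \<open>J\<close> is not contained in \<open>P\<close>, then
  \<open>J + P\<close> contains some term of the sequence, so the next term lies in \<open>(J + P) * (J + P) \<subseteq> P\<close>.
\<close>

context skew_brace
begin

section \<open>The two group structures and the lambda action\<close>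

sublocale add: group "add_monoid A"
  rewrites "carrier (add_monoid A) = carrier A"
    and "monoid.mult (add_monoid A) = ring.add A"
    and "monoid.one (add_monoid A) = ring.zero A"
    and "m_inv (add_monoid A) = a_inv A"
    and "pow (add_monoid A) = (\<lambda>a k. add_pow A k a)"
  by (rule add_group) (auto simp: m_inv_def a_inv_def add_pow_def)

sublocale group A
  by (rule circ_group)

abbreviation lam :: "'a \<Rightarrow> 'a \<Rightarrow> 'a" where "lam \<equiv> sb_lambda A"
abbreviation star :: "'a \<Rightarrow> 'a \<Rightarrow> 'a" where "star \<equiv> sb_star A"

lemma minus_closed: "\<lbrakk>x \<in> carrier A; y \<in> carrier A\<rbrakk> \<Longrightarrow> x \<ominus> y \<in> carrier A"
  by (simp add: a_minus_def)

lemma add_cancel_simps [simp]: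
  assumes "x \<in> carrier A" "y \<in> carrier A"
  shows "x \<oplus> (\<ominus> x \<oplus> y) = y" "\<ominus> x \<oplus> (x \<oplus> y) = y"
  using assms by (simp_all flip: add.m_assoc)

lemma circ_cancel_simps [simp]:
  assumes "x \<in> carrier A" "y \<in> carrier A"
  shows "x \<otimes> (inv x \<otimes> y) = y" "inv x \<otimes> (x \<otimes> y) = y"
  using assms by (simp_all flip: m_assoc)

lemma one_eq_zero: "\<one> = \<zero>"
proof -
  have "\<one> \<otimes> (\<zero> \<oplus> \<zero>) = ((\<one> \<otimes> \<zero>) \<ominus> \<one>) \<oplus> (\<one> \<otimes> \<zero>)"
    by (rule skew_distrib) auto
  then have "\<ominus> \<one> = \<zero>"
    by (simp add: a_minus_def)
  then show ?thesis
    by (metis add.inv_inv add.inv_one one_closed)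
qed

lemma lam_closed [simp, intro]: "\<lbrakk>a \<in> carrier A; b \<in> carrier A\<rbrakk> \<Longrightarrow> lam a b \<in> carrier A"
  by (simp add: sb_lambda_def)

lemma circ_eq: "\<lbrakk>a \<in> carrier A; b \<in> carrier A\<rbrakk> \<Longrightarrow> a \<otimes> b = a \<oplus> lam a b"
  by (simp add: sb_lambda_def)

lemma lam_add:
  assumes "a \<in> carrier A" "b \<in> carrier A" "c \<in> carrier A"
  shows "lam a (b \<oplus> c) = lam a b \<oplus> lam a c"
  using assms by (simp add: sb_lambda_def skew_distrib a_minus_def add.m_assoc)

lemma lam_zero: "a \<in> carrier A \<Longrightarrow> lam a \<zero> = \<zero>"
  by (metis add.l_inv one_eq_zero r_one sb_lambda_def)

lemma lam_one: "b \<in> carrier A \<Longrightarrow> lam \<one> b = b"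
  \<comment> \<open>The unit law has to fire before \<open>one_eq_zero\<close> turns
    \<open>\<one>\<close> into \<open>\<zero>\<close>, hence two passes.\<close>
  by (simp add: sb_lambda_def) (simp add: one_eq_zero)

lemma lam_neg:
  assumes "a \<in> carrier A" "b \<in> carrier A"
  shows "lam a (\<ominus> b) = \<ominus> lam a b"
  by (metis assms lam_add lam_zero lam_closed add.inv_closed add.l_inv add.inv_equality)

text \<open>By additivity of \<open>lam a\<close>, the left factor of \<open>lam b c\<close> becomes
  \<open>\<ominus> lam a b\<close>, and the terms in \<open>a\<close> alone cancel. With
  \<open>lam_one\<close> and \<open>lam_add\<close> this makes \<open>lam\<close> an action of the
  circle group by additive maps.\<close>

lemma lam_circ:
  assumes "a \<in> carrier A" "b \<in> carrier A" "c \<in> carrier A"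
  shows "lam (a \<otimes> b) c = lam a (lam b c)"
proof -
  have "lam a (lam b c) = \<ominus> lam a b \<oplus> lam a (b \<otimes> c)"
    using assms by (simp add: sb_lambda_def[of A b c] lam_add lam_neg)
  also have "\<dots> = lam (a \<otimes> b) c"
    using assms by (simp add: sb_lambda_def add.inv_mult_group add.m_assoc m_assoc)
  finally show ?thesis ..
qed

text \<open>\<open>lam a\<close> undoes \<open>lam (inv a)\<close>, so \<open>circ_eq\<close> can be
  inverted. This is how sums are reached in a set known only to be closed under
  \<open>\<otimes>\<close>.\<close>

lemma add_eq_circ:
  assumes "a \<in> carrier A" "b \<in> carrier A"
  shows "a \<oplus> b = a \<otimes> lam (inv a) b"
  using assms by (simp add: circ_eq[of a "lam (inv a) b"] lam_one flip: lam_circ)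

lemma lam_inv_self: "a \<in> carrier A \<Longrightarrow> lam (inv a) a = \<ominus> (inv a)"
  by (simp add: sb_lambda_def) (simp add: one_eq_zero)

section \<open>Ideals described elementwise\<close>

lemma a_coset_eq_iff_add_normal:
  assumes "subgroup I (add_monoid A)"
  shows "(\<forall>a\<in>carrier A. a <+ I = I +> a) \<longleftrightarrow> I \<lhd> add_monoid A"
  using assms add_group
  by (auto simp: normal_def normal_axioms_def a_l_coset_def a_r_coset_def)

text \<open>The definition supplies closure for the circle group only; additive closure comes from
  \<open>x \<oplus> y = x \<otimes> lam (inv x) y\<close> and
  \<open>\<ominus> x = lam x (inv x)\<close>. Only then can the coset condition be read as additive
  normality.\<close>

lemma sb_idealD:
  assumes "sb_ideal A I"
  shows "I \<subseteq> carrier A" "\<zero> \<in> I"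
    and "\<And>x y. \<lbrakk>x \<in> I; y \<in> I\<rbrakk> \<Longrightarrow> x \<oplus> y \<in> I"
    and "\<And>x. x \<in> I \<Longrightarrow> \<ominus> x \<in> I"
    and "\<And>a x. \<lbrakk>a \<in> carrier A; x \<in> I\<rbrakk> \<Longrightarrow> a \<oplus> x \<oplus> \<ominus> a \<in> I"
    and "\<And>a x. \<lbrakk>a \<in> carrier A; x \<in> I\<rbrakk> \<Longrightarrow> lam a x \<in> I"
    and "\<And>a x. \<lbrakk>a \<in> carrier A; x \<in> I\<rbrakk> \<Longrightarrow> a \<otimes> x \<otimes> inv a \<in> I"
proof -
  have n: "I \<lhd> A" and coset: "\<forall>a\<in>carrier A. a <+ I = I +> a"
    and lam: "\<And>a x. \<lbrakk>a \<in> carrier A; x \<in> I\<rbrakk> \<Longrightarrow> lam a x \<in> I"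
    using assms by (auto simp: sb_ideal_def)
  interpret I: subgroup I A
    using n by (rule normal_imp_subgroup)
  show sub: "I \<subseteq> carrier A"
    by (rule I.subset)
  show zero: "\<zero> \<in> I"
    using I.one_closed by (simp add: one_eq_zero)
  show plus: "x \<oplus> y \<in> I" if "x \<in> I" "y \<in> I" for x y
    using that lam sub by (auto simp: add_eq_circ)
  show neg: "\<ominus> x \<in> I" if "x \<in> I" for x
    using that lam_inv_self[of "inv x"] lam[of x "inv x"] sub by auto
  show "lam a x \<in> I" if "a \<in> carrier A" "x \<in> I" for a x
    using that by (rule lam)
  show "a \<otimes> x \<otimes> inv a \<in> I" if "a \<in> carrier A" "x \<in> I" for a x
    using that n by (simp add: normal_inv_iff)
  have "subgroup I (add_monoid A)"
    using sub zero plus neg by (auto intro!: add.subgroupI)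
  then have "I \<lhd> add_monoid A"
    using coset a_coset_eq_iff_add_normal by blast
  then show "a \<oplus> x \<oplus> \<ominus> a \<in> I" if "a \<in> carrier A" "x \<in> I" for a x
    using that by (simp add: add.normal_inv_iff)
qed

text \<open>The reverse passage: \<open>x \<otimes> y = x \<oplus> lam x y\<close> and
  \<open>inv x = \<ominus> lam (inv x) x\<close> recover the circle subgroup.\<close>

lemma sb_idealI:
  assumes sub: "I \<subseteq> carrier A" and zero: "\<zero> \<in> I"
    and plus: "\<And>x y. \<lbrakk>x \<in> I; y \<in> I\<rbrakk> \<Longrightarrow> x \<oplus> y \<in> I"
    and neg: "\<And>x. x \<in> I \<Longrightarrow> \<ominus> x \<in> I"
    and conj: "\<And>a x. \<lbrakk>a \<in> carrier A; x \<in> I\<rbrakk> \<Longrightarrow> a \<oplus> x \<oplus> \<ominus> a \<in> I"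
    and lam: "\<And>a x. \<lbrakk>a \<in> carrier A; x \<in> I\<rbrakk> \<Longrightarrow> lam a x \<in> I"
    and circ_conj: "\<And>a x. \<lbrakk>a \<in> carrier A; x \<in> I\<rbrakk> \<Longrightarrow> a \<otimes> x \<otimes> inv a \<in> I"
  shows "sb_ideal A I"
proof -
  have a: "subgroup I (add_monoid A)"
    using sub zero plus neg by (auto intro!: add.subgroupI)
  have an: "I \<lhd> add_monoid A"
    using a conj by (simp add: add.normal_inv_iff)
  have inv: "inv x \<in> I" if "x \<in> I" for x
  proof -
    have "inv x = \<ominus> lam (inv x) x"
      using that sub by (auto simp: lam_inv_self)
    then show ?thesis
      using that sub lam neg by (metis inv_closed subsetD)
  qed
  have "subgroup I A"
    using sub zero inv plus lam by (intro subgroupI) (auto simp: circ_eq subsetD)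
  then have "I \<lhd> A"
    using circ_conj by (simp add: normal_inv_iff)
  then show ?thesis
    using an a a_coset_eq_iff_add_normal lam by (auto simp: sb_ideal_def)
qed

section \<open>Intersections, chains and sums of ideals\<close>

lemma sb_ideal_zero: "sb_ideal A {\<zero>}"
proof (rule sb_idealI)
  show "a \<otimes> x \<otimes> inv a \<in> {\<zero>}" if "a \<in> carrier A" "x \<in> {\<zero>}" for a x
    using that by (simp flip: one_eq_zero)
qed (auto simp: lam_zero)

lemma sb_ideal_carrier: "sb_ideal A (carrier A)"
  by (rule sb_idealI) auto

lemma sb_ideal_Inter:
  assumes "\<I> \<noteq> {}" "\<And>I. I \<in> \<I> \<Longrightarrow> sb_ideal A I"
  shows "sb_ideal A (\<Inter>\<I>)"
proof (rule sb_idealI)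
  note D = sb_idealD[OF assms(2)]
  show "\<Inter>\<I> \<subseteq> carrier A"
    using D(1) assms(1) by blast
qed (auto intro: sb_idealD[OF assms(2)])

lemma sb_ideal_Union_chain:
  assumes ne: "\<C> \<noteq> {}" and chain: "subset.chain {I. sb_ideal A I} \<C>"
  shows "sb_ideal A (\<Union>\<C>)"
proof (rule sb_idealI)
  have I: "\<And>I. I \<in> \<C> \<Longrightarrow> sb_ideal A I" and tot: "\<And>I J. \<lbrakk>I \<in> \<C>; J \<in> \<C>\<rbrakk> \<Longrightarrow> I \<subseteq> J \<or> J \<subseteq> I"
    using chain by (auto simp: subset.chain_def)
  show "\<Union>\<C> \<subseteq> carrier A" "\<zero> \<in> \<Union>\<C>"
    using I ne sb_idealD(1,2) by blast+
  show "x \<oplus> y \<in> \<Union>\<C>" if "x \<in> \<Union>\<C>" "y \<in> \<Union>\<C>" for x y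
  proof -
    obtain K where "K \<in> \<C>" "x \<in> K" "y \<in> K"
      using \<open>x \<in> \<Union>\<C>\<close> \<open>y \<in> \<Union>\<C>\<close> tot by blast
    then show ?thesis
      using I sb_idealD(3) by blast
  qed
  show "\<ominus> x \<in> \<Union>\<C>" if "x \<in> \<Union>\<C>" for x
    using that I sb_idealD(4) by blast
  show "a \<oplus> x \<oplus> \<ominus> a \<in> \<Union>\<C>" "lam a x \<in> \<Union>\<C>" "a \<otimes> x \<otimes> inv a \<in> \<Union>\<C>"
    if "a \<in> carrier A" "x \<in> \<Union>\<C>" for a x
    using that I sb_idealD(5-7) by blast+
qed

lemma sb_ideal_sum:
  assumes J: "sb_ideal A J" and P: "sb_ideal A P"
  shows "sb_ideal A (J <+>\<^bsub>A\<^esub> P)"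
proof -
  note JD = sb_idealD[OF J] and PD = sb_idealD[OF P]
  have JC: "x \<in> carrier A" if "x \<in> J" for x using that JD(1) by blast
  have PC: "x \<in> carrier A" if "x \<in> P" for x using that PD(1) by blast
  have sumI: "j \<oplus> p \<in> J <+>\<^bsub>A\<^esub> P" if "j \<in> J" "p \<in> P" for j p
    using that by (auto simp: set_add_def')
  have sumE: "\<exists>j\<in>J. \<exists>p\<in>P. x = j \<oplus> p" if "x \<in> J <+>\<^bsub>A\<^esub> P" for x
    using that by (auto simp: set_add_def')
  show ?thesis
  proof (rule sb_idealI)
    show "J <+>\<^bsub>A\<^esub> P \<subseteq> carrier A"
      using sumE JC PC by fastforce
    show "\<zero> \<in> J <+>\<^bsub>A\<^esub> P"
      using sumI[OF JD(2) PD(2)] by simp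
    show "x \<oplus> y \<in> J <+>\<^bsub>A\<^esub> P" if xy: "x \<in> J <+>\<^bsub>A\<^esub> P" "y \<in> J <+>\<^bsub>A\<^esub> P" for x y
    proof -
      obtain j p j' p' where *: "j \<in> J" "p \<in> P" "j' \<in> J" "p' \<in> P" "x = j \<oplus> p" "y = j' \<oplus> p'"
        using sumE xy by meson
      \<comment> \<open>\<open>j'\<close> moves left past \<open>p\<close> at the price of
        conjugating \<open>p\<close> by \<open>\<ominus> j'\<close>, which stays in
        \<open>P\<close>; the double negation matches the shape of the conjugation rule.\<close>
      have "x \<oplus> y = (j \<oplus> j') \<oplus> ((\<ominus> j' \<oplus> p \<oplus> \<ominus> (\<ominus> j')) \<oplus> p')"
        using * JC PC by (simp add: add.m_assoc)
      then show ?thesis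
        using * JC by (simp only:) (intro sumI JD PD add.inv_closed; simp)
    qed
    show "\<ominus> x \<in> J <+>\<^bsub>A\<^esub> P" if x: "x \<in> J <+>\<^bsub>A\<^esub> P" for x
    proof -
      obtain j p where *: "j \<in> J" "p \<in> P" "x = j \<oplus> p"
        using sumE x by meson
      have "\<ominus> x = \<ominus> j \<oplus> (j \<oplus> \<ominus> p \<oplus> \<ominus> j)"
        using * JC PC by (simp add: add.m_assoc add.inv_mult_group)
      then show ?thesis
        using * JC by (simp only:) (intro sumI JD PD; simp)
    qed
    fix a x assume a: "a \<in> carrier A" and x: "x \<in> J <+>\<^bsub>A\<^esub> P"
    obtain j p where *: "j \<in> J" "p \<in> P" "x = j \<oplus> p"
      using sumE x by meson
    have "a \<oplus> x \<oplus> \<ominus> a = (a \<oplus> j \<oplus> \<ominus> a) \<oplus> (a \<oplus> p \<oplus> \<ominus> a)"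
      using * JC PC a by (simp add: add.m_assoc)
    then show "a \<oplus> x \<oplus> \<ominus> a \<in> J <+>\<^bsub>A\<^esub> P"
      using * a by (simp only:) (intro sumI JD PD)
    show "lam a x \<in> J <+>\<^bsub>A\<^esub> P"
      using * a JC PC sumI JD(6) PD(6) by (simp add: lam_add)
    \<comment> \<open>Circle conjugation need not distribute over \<open>\<oplus>\<close>, so
      \<open>x\<close> is rewritten as \<open>j \<otimes> q\<close> with \<open>q\<close> in
      \<open>P\<close>; \<open>circ_eq\<close> turns the product of the conjugates back into a
      sum.\<close>
    define q where "q = lam (inv j) p"
    have q: "q \<in> P" "x = j \<otimes> q"
      using * JC PC PD(6) by (auto simp: q_def add_eq_circ)
    have "a \<otimes> x \<otimes> inv a = (a \<otimes> j \<otimes> inv a) \<otimes> (a \<otimes> q \<otimes> inv a)"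
      using *(1) q JC PC a by (simp only: q(2)) (simp add: m_assoc)
    also have "\<dots> = (a \<otimes> j \<otimes> inv a) \<oplus> lam (a \<otimes> j \<otimes> inv a) (a \<otimes> q \<otimes> inv a)"
      using * q JC PC a by (intro circ_eq) auto
    also have "\<dots> \<in> J <+>\<^bsub>A\<^esub> P"
      using * q a JC by (intro sumI JD PD; simp)
    finally show "a \<otimes> x \<otimes> inv a \<in> J <+>\<^bsub>A\<^esub> P" .
  qed
qed

lemma sum_upper:
  assumes "sb_ideal A J" "sb_ideal A P"
  shows "J \<subseteq> J <+>\<^bsub>A\<^esub> P" "P \<subseteq> J <+>\<^bsub>A\<^esub> P"
proof -
  have "j \<in> J <+>\<^bsub>A\<^esub> P" if "j \<in> J" for j
    using that sb_idealD(1)[OF assms(1)] sb_idealD(2)[OF assms(2)]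
    unfolding set_add_def' by (auto intro!: bexI[of _ j] bexI[where x = \<zero> and A = P])
  moreover have "p \<in> J <+>\<^bsub>A\<^esub> P" if "p \<in> P" for p
    using that sb_idealD(1)[OF assms(2)] sb_idealD(2)[OF assms(1)]
    unfolding set_add_def' by (auto intro!: bexI[of _ p] bexI[where x = \<zero> and A = J])
  ultimately show "J \<subseteq> J <+>\<^bsub>A\<^esub> P" "P \<subseteq> J <+>\<^bsub>A\<^esub> P" by blast+
qed

section \<open>The star product modulo an ideal\<close>

lemma lam_ideal_cong:
  assumes P: "sb_ideal A P" and q: "q \<in> P" and b: "b \<in> carrier A"
  shows "\<exists>p\<in>P. lam q b = b \<oplus> p"
proof -
  note PD = sb_idealD[OF P]
  have PC: "x \<in> carrier A" if "x \<in> P" for x using that PD(1) by blast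
  \<comment> \<open>Circle normality gives \<open>q \<otimes> b = b \<otimes> r\<close> with
    \<open>r\<close> in \<open>P\<close>. Expanding this and moving \<open>\<ominus> q\<close> past
    \<open>b\<close> leaves an error in \<open>P\<close>, so elements of \<open>P\<close> act
    trivially modulo \<open>P\<close>.\<close>
  define r where "r = inv b \<otimes> q \<otimes> inv (inv b)"
  have r: "r \<in> P" using q b by (simp only: r_def) (intro PD; simp)
  have "q \<otimes> b = b \<otimes> r"
    using q b PC by (simp add: r_def m_assoc)
  then have "lam q b = \<ominus> q \<oplus> (b \<oplus> lam b r)"
    using r b PC by (simp add: sb_lambda_def[of A q] circ_eq)
  also have "\<dots> = b \<oplus> ((\<ominus> b \<oplus> \<ominus> q \<oplus> \<ominus> (\<ominus> b)) \<oplus> lam b r)"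
    using r b q PC by (simp add: add.m_assoc)
  finally show ?thesis
    using r b q by (meson PD(3-6) add.inv_closed)
qed

text \<open>Writing \<open>a \<oplus> p = a \<otimes> q\<close> splits the action into
  \<open>lam a\<close> after \<open>lam q\<close>, and \<open>lam q\<close> is trivial modulo
  \<open>P\<close>. This congruence stands in for computing in the quotient by
  \<open>P\<close>.\<close>

lemma star_ideal_cong:
  assumes P: "sb_ideal A P" and a: "a \<in> carrier A" "b \<in> carrier A" and p: "p \<in> P" "p' \<in> P"
    and ab: "star a b \<in> P"
  shows "star (a \<oplus> p) (b \<oplus> p') \<in> P"
proof -
  note PD = sb_idealD[OF P]
  have PC [simp]: "x \<in> carrier A" if "x \<in> P" for x using that PD(1) by blast
  define q where "q = lam (inv a) p"
  have q: "q \<in> P" "a \<oplus> p = a \<otimes> q"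
    using a p PD(6) by (auto simp: q_def add_eq_circ)
  obtain r where r: "r \<in> P" "lam q b = b \<oplus> r"
    using lam_ideal_cong[OF P q(1) a(2)] by blast
  \<comment> \<open>\<open>t\<close> gathers the errors: subtracting \<open>b \<oplus> p'\<close>
    gives \<open>lam a b \<oplus> t \<oplus> \<ominus> b\<close>, which is \<open>star a b\<close>
    plus a conjugate of \<open>t\<close>.\<close>
  define t where "t = lam a (r \<oplus> lam q p') \<oplus> \<ominus> p'"
  have t: "t \<in> P"
    using a p q r by (simp only: t_def) (intro PD; simp)
  have "lam (a \<oplus> p) (b \<oplus> p') = lam a (lam q b \<oplus> lam q p')"
    using a p q by (simp add: lam_circ lam_add)
  also have "\<dots> = lam a b \<oplus> lam a (r \<oplus> lam q p')"
    using a p q(1) r by (simp add: lam_add add.m_assoc)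
  finally have "star (a \<oplus> p) (b \<oplus> p') = star a b \<oplus> (b \<oplus> t \<oplus> \<ominus> b)"
    using a p q(1) r by (simp add: sb_star_def a_minus_def t_def add.m_assoc add.inv_mult_group)
  then show ?thesis
    using PD(3,5) ab a t by simp
qed

text \<open>An ideal is an additive subgroup, so testing the generators suffices.\<close>

lemma sb_star_set_subset_ideal_iff:
  assumes "sb_ideal A P"
  shows "sb_star_set A S T \<subseteq> P \<longleftrightarrow> (\<forall>x\<in>S. \<forall>y\<in>T. star x y \<in> P)"
proof
  assume "sb_star_set A S T \<subseteq> P"
  then show "\<forall>x\<in>S. \<forall>y\<in>T. star x y \<in> P"
    by (auto simp: sb_star_set_def intro: generate.incl)
next
  assume "\<forall>x\<in>S. \<forall>y\<in>T. star x y \<in> P"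
  moreover have "subgroup P (add_monoid A)"
    using sb_idealD[OF assms] by (auto intro!: add.subgroupI)
  ultimately show "sb_star_set A S T \<subseteq> P"
    unfolding sb_star_set_def by (intro add.generate_subgroup_incl) auto
qed

lemma sb_star_set_mono:
  assumes "S \<subseteq> S'" "T \<subseteq> T'"
  shows "sb_star_set A S T \<subseteq> sb_star_set A S' T'"
  unfolding sb_star_set_def using assms by (intro add.mono_generate) blast

lemma sb_star_set_carrier:
  assumes "S \<subseteq> carrier A" "T \<subseteq> carrier A"
  shows "sb_star_set A S T \<subseteq> carrier A"
  unfolding sb_star_set_subset_ideal_iff[OF sb_ideal_carrier]
  using assms by (auto simp: sb_star_def intro!: minus_closed)

lemma zero_in_sb_star_set: "\<zero> \<in> sb_star_set A S T"
  unfolding sb_star_set_def using generate.one[of "add_monoid A"] by simp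

text \<open>Each generator \<open>star (j \<oplus> p) (j' \<oplus> p')\<close> inherits membership
  in \<open>P\<close> from \<open>star j j'\<close>. Hence \<open>J\<close> may be enlarged by
  \<open>P\<close> in the maximality argument.\<close>

lemma sb_star_set_sum:
  assumes J: "sb_ideal A J" and P: "sb_ideal A P" and JJ: "sb_star_set A J J \<subseteq> P"
  shows "sb_star_set A (J <+>\<^bsub>A\<^esub> P) (J <+>\<^bsub>A\<^esub> P) \<subseteq> P"
  using JJ star_ideal_cong[OF P] sb_idealD(1)[OF J]
  unfolding sb_star_set_subset_ideal_iff[OF P] by (auto simp: set_add_def' subset_iff)

section \<open>Generated ideals and semiprime ideals\<close>

lemma sb_ideal_genideal: "a \<in> carrier A \<Longrightarrow> sb_ideal A (sb_genideal A a)"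
  unfolding sb_genideal_def using sb_ideal_carrier by (intro sb_ideal_Inter) auto

lemma in_sb_genideal: "a \<in> sb_genideal A a"
  by (simp add: sb_genideal_def)

lemma sb_genideal_subset: "\<lbrakk>sb_ideal A I; a \<in> I\<rbrakk> \<Longrightarrow> sb_genideal A a \<subseteq> I"
  by (auto simp: sb_genideal_def)

text \<open>The relative form of \<open>sb_semiprime\<close>: it expresses semiprimeness of the
  quotient by \<open>P\<close> without forming that quotient. The whole carrier qualifies.\<close>

definition semiprime_ideal :: "'a set \<Rightarrow> bool" where
  "semiprime_ideal P \<longleftrightarrow> sb_ideal A P \<and>
     (\<forall>J. sb_ideal A J \<longrightarrow> sb_star_set A J J \<subseteq> P \<longrightarrow> J \<subseteq> P)"

lemma sb_semiprime_iff: "sb_semiprime A \<longleftrightarrow> semiprime_ideal {\<zero>}"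
proof -
  have "sb_star_set A J J \<subseteq> {\<zero>} \<longleftrightarrow> sb_star_set A J J = {\<zero>}" for J
    using zero_in_sb_star_set by blast
  moreover have "J \<subseteq> {\<zero>} \<longleftrightarrow> J = {\<zero>}" if "sb_ideal A J" for J
    using sb_idealD(2)[OF that] by blast
  ultimately show ?thesis
    unfolding sb_semiprime_def semiprime_ideal_def using sb_ideal_zero by auto
qed

definition semiprime_radical :: "'a set" where
  "semiprime_radical = \<Inter>{P. semiprime_ideal P}"

lemma semiprime_ideal_carrier: "semiprime_ideal (carrier A)"
  by (simp add: semiprime_ideal_def sb_ideal_carrier sb_idealD(1))

text \<open>If a star square lies in the intersection, it lies in every member, and hence so does
  \<open>J\<close>. The carrier keeps the family nonempty.\<close>

lemma semiprime_ideal_radical: "semiprime_ideal semiprime_radical"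
proof -
  have "sb_ideal A semiprime_radical"
    unfolding semiprime_radical_def using semiprime_ideal_carrier
    by (intro sb_ideal_Inter) (auto simp: semiprime_ideal_def)
  then show ?thesis
    unfolding semiprime_ideal_def semiprime_radical_def by (simp add: le_Inf_iff)
qed

section \<open>n-sequences and the Baer radical\<close>

lemma n_sequence_avoiding:
  assumes P: "semiprime_ideal P" and a: "a \<in> carrier A" "a \<notin> P"
  shows "\<exists>s. n_sequence A s \<and> s 0 = a \<and> (\<forall>i. s i \<notin> P)"
proof -
  \<comment> \<open>The clause on \<open>n = 0\<close> pins the first term to \<open>a\<close>
    within dependent choice.\<close>
  have "\<exists>s. \<forall>n. (s n \<in> carrier A - P \<and> (n = 0 \<longrightarrow> s n = a)) \<and>
      s (Suc n) \<in> sb_star_set A (sb_genideal A (s n)) (sb_genideal A (s n))"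
  proof (rule dependent_nat_choice)
    show "\<exists>x. x \<in> carrier A - P \<and> (0 = (0::nat) \<longrightarrow> x = a)"
      using a by simp
    fix x and n :: nat
    assume x: "x \<in> carrier A - P \<and> (n = 0 \<longrightarrow> x = a)"
    let ?S = "sb_star_set A (sb_genideal A x) (sb_genideal A x)"
    have G: "sb_ideal A (sb_genideal A x)"
      using x by (simp add: sb_ideal_genideal)
    \<comment> \<open>\<open>x\<close> witnesses that its generated ideal is not inside
      \<open>P\<close>; semiprimeness passes this on to the star square, which supplies the next
      term.\<close>
    have "\<not> ?S \<subseteq> P"
      using P G x in_sb_genideal unfolding semiprime_ideal_def by blast
    moreover have "?S \<subseteq> carrier A"
      using sb_star_set_carrier sb_idealD(1)[OF G] by blast
    ultimately show "\<exists>y. (y \<in> carrier A - P \<and> (Suc n = 0 \<longrightarrow> y = a)) \<and> y \<in> ?S"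
      by blast
  qed
  then show ?thesis
    unfolding n_sequence_def by blast
qed

lemma semiprime_ideal_if_maximal_avoiding:
  assumes s: "n_sequence A s" and P: "sb_ideal A P" and disj: "P \<inter> range s = {}"
    and max: "\<And>I. \<lbrakk>sb_ideal A I; I \<inter> range s = {}; P \<subseteq> I\<rbrakk> \<Longrightarrow> I = P"
  shows "semiprime_ideal P"
  unfolding semiprime_ideal_def
proof (intro conjI allI impI P)
  fix J assume J: "sb_ideal A J" and JJ: "sb_star_set A J J \<subseteq> P"
  show "J \<subseteq> P"
  proof (rule ccontr)
    assume "\<not> J \<subseteq> P"
    then have "J <+>\<^bsub>A\<^esub> P \<noteq> P"
      using sum_upper(1)[OF J P] by blast
    then obtain i where "s i \<in> J <+>\<^bsub>A\<^esub> P"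
      using max[OF sb_ideal_sum[OF J P] _ sum_upper(2)[OF J P]] by blast
    then have "sb_genideal A (s i) \<subseteq> J <+>\<^bsub>A\<^esub> P"
      by (rule sb_genideal_subset[OF sb_ideal_sum[OF J P]])
    \<comment> \<open>The sequence meets the sum at index \<open>i\<close>, but the contradiction
      arises at \<open>Suc i\<close>, so \<open>P\<close> has to avoid the entire range.\<close>
    then have "s (Suc i) \<in> sb_star_set A (J <+>\<^bsub>A\<^esub> P) (J <+>\<^bsub>A\<^esub> P)"
      using s sb_star_set_mono unfolding n_sequence_def by blast
    then show False
      using sb_star_set_sum[OF J P JJ] disj by blast
  qed
qed

lemma baer_radical_ideal_semiprime_radical: "baer_radical_ideal A semiprime_radical"
  unfolding baer_radical_ideal_def
proof (intro conjI allI impI)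
  show "sb_ideal A semiprime_radical"
    using semiprime_ideal_radical by (simp add: semiprime_ideal_def)
  fix s assume s: "n_sequence A s \<and> s 0 \<in> semiprime_radical"
  show "\<exists>i. s i = \<zero>"
  proof (rule ccontr)
    assume "\<nexists>i. s i = \<zero>"
    \<comment> \<open>The zero ideal makes the family for Zorn's lemma nonempty: it avoids the
      sequence precisely because no term vanishes.\<close>
    then have "{\<zero>} \<in> {I. sb_ideal A I \<and> I \<inter> range s = {}}"
      using sb_ideal_zero by auto
    then have "\<exists>P\<in>{I. sb_ideal A I \<and> I \<inter> range s = {}}.
        \<forall>I\<in>{I. sb_ideal A I \<and> I \<inter> range s = {}}. P \<subseteq> I \<longrightarrow> I = P"
    proof (intro subset_Zorn_nonempty)
      fix \<C> assume ne: "\<C> \<noteq> {}" and ch: "subset.chain {I. sb_ideal A I \<and> I \<inter> range s = {}} \<C>"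
      then have "subset.chain {I. sb_ideal A I} \<C>"
        by (auto simp: subset.chain_def)
      then show "\<Union>\<C> \<in> {I. sb_ideal A I \<and> I \<inter> range s = {}}"
        using sb_ideal_Union_chain[OF ne] ch by (auto simp: subset.chain_def)
    qed auto
    then obtain P where P: "sb_ideal A P" "P \<inter> range s = {}"
      and max: "\<And>I. \<lbrakk>sb_ideal A I; I \<inter> range s = {}; P \<subseteq> I\<rbrakk> \<Longrightarrow> I = P"
      by auto
    have "semiprime_ideal P"
      using s P max by (intro semiprime_ideal_if_maximal_avoiding) auto
    \<comment> \<open>\<open>s 0\<close> lies in every semiprime ideal, in particular in
      \<open>P\<close>, which avoids the sequence.\<close>
    then show False
      using s P(2) by (auto simp: semiprime_radical_def)
  qed
qed

text \<open>As \<open>semiprime_radical\<close> is itself semiprime, an element outside it starts an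
  n-sequence that never enters it. Since \<open>\<zero>\<close> lies inside, that sequence never
  vanishes.\<close>

lemma baer_radical_ideal_subset:
  assumes "baer_radical_ideal A I"
  shows "I \<subseteq> semiprime_radical"
proof (rule subsetI, rule ccontr)
  fix a assume a: "a \<in> I" "a \<notin> semiprime_radical"
  have "a \<in> carrier A"
    using assms a(1) sb_idealD(1) unfolding baer_radical_ideal_def by blast
  then obtain s where "n_sequence A s" "s 0 = a" "\<forall>i. s i \<notin> semiprime_radical"
    using n_sequence_avoiding[OF semiprime_ideal_radical] a(2) by blast
  moreover have "\<zero> \<in> semiprime_radical"
    using semiprime_ideal_radical sb_idealD(2) by (simp add: semiprime_ideal_def)
  ultimately show False
    using assms a(1) unfolding baer_radical_ideal_def by metis
qed

text \<open>The existence of a greatest Baer radical ideal is obtained here by exhibiting it, which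
  gives \<open>GREATEST\<close> its meaning.\<close>

lemma baer_radical_eq: "baer_radical A = semiprime_radical"
  unfolding baer_radical_def
  by (rule Greatest_equality)
    (auto intro: baer_radical_ideal_semiprime_radical dest: baer_radical_ideal_subset)

lemma sb_semiprime_iff_baer_radical: "sb_semiprime A \<longleftrightarrow> baer_radical A = {\<zero>}"
proof
  assume "sb_semiprime A"
  then have "semiprime_radical \<subseteq> {\<zero>}"
    unfolding sb_semiprime_iff semiprime_radical_def by blast
  moreover have "\<zero> \<in> semiprime_radical"
    using semiprime_ideal_radical sb_idealD(2) by (simp add: semiprime_ideal_def)
  ultimately show "baer_radical A = {\<zero>}"
    unfolding baer_radical_eq by blast
next
  assume "baer_radical A = {\<zero>}"
  then show "sb_semiprime A"
    using semiprime_ideal_radical by (simp add: sb_semiprime_iff baer_radical_eq)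
qed

end

theorem theorem4p21:
  fixes A :: "('a, 'b) ring_scheme"
  assumes "skew_brace A"
  shows "sb_semiprime A \<longleftrightarrow> baer_radical A = {\<zero>\<^bsub>A\<^esub>}"
  using assms by (rule skew_brace.sb_semiprime_iff_baer_radical)

end
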